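(* If the continuum hypothesis holds, then there is an uncountable null-additive set $X\subseteq{}^{\omega}2$.
   Context: ${}^{\omega}2$ is the set of infinite $0$-$1$ sequences with componentwise addition modulo 2; for $A,B\subseteq{}^\omega2$, $A+B=\{a+b:a\in A,b\in B\}$; $\mu$ is Lebesgue (fair-coin product) measure on ${}^{\omega}2$. $X\subseteq{}^{\omega}2$ is null-additive if $\mu(X+A)=0$ for every $A\subseteq{}^{\omega}2$ with $\mu(A)=0$. *)

theory Defs
  imports
    "HOL-Probability.Probability"
    "HOL-Library.Z2"
    "HOL-Library.Function_Algebras"
    "HOL-Library.Set_Algebras"
begin

unbundle cardinal_syntax

text \<open>
  The Cantor space is the type \<^typ>\<open>nat \<Rightarrow> bit\<close>, where \<^typ>\<open>bit\<close> is the two-element field;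
  \<open>a + b\<close> is componentwise addition modulo 2 and \<open>A + B\<close> is the Minkowski sum of sets.
\<close>

text \<open>
  Lebesgue measure is the completion of the countable product of the fair-coin measures, so its
  null sets are exactly the subsets of Borel null sets. Membership in \<^const>\<open>null_sets\<close> is used for
  ``\<open>A\<close> has measure zero'', because \<^const>\<open>emeasure\<close> is also 0 on every nonmeasurable set.
\<close>

definition cantor_measure :: "(nat \<Rightarrow> bit) measure" where
  "cantor_measure = completion (\<Pi>\<^sub>M n\<in>UNIV. uniform_count_measure UNIV)"

definition null_additive :: "(nat \<Rightarrow> bit) set \<Rightarrow> bool" where
  "null_additive X \<longleftrightarrow>
     (\<forall>A. A \<in> null_sets cantor_measure \<longrightarrow> X + A \<in> null_sets cantor_measure)"

text \<open>The cardinality of the continuum is the successor cardinal of \<open>\<aleph>\<^sub>0\<close>.\<close>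

definition continuum_hypothesis :: bool where
  "continuum_hypothesis \<longleftrightarrow> |UNIV :: real set| =o cardSuc natLeq"

end

theory Submission
  imports Defs
begin

text \<open>
  Say that \<open>x\<close> is caught by a set \<open>S\<close> of finite words if infinitely many initial segments of \<open>x\<close>
  lie in \<open>S\<close>. Every null set is caught by some \<open>S\<close> whose cylinders have finite total measure
  (\<open>null_set_cover\<close>), and by the Borel--Cantelli lemma every such \<open>S\<close> catches only a null set. So
  it suffices to treat sets \<open>S\<close> of words, and of these there are only continuum many.

  Adding a set \<open>Y\<close> of sequences to what \<open>S\<close> catches multiplies the number of words of length \<open>k\<close> at
  most by the number of initial segments of length \<open>k\<close> of members of \<open>Y\<close>. If \<open>Y\<close> consists of the
  characteristic functions of the subsets of \<open>b\<close>, this factor is \<open>2\<close> to the power of the number of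
  elements of \<open>b\<close> below \<open>k\<close>. Because the tails of a convergent series tend to \<open>0\<close>, every infinite
  set has an infinite subset \<open>b\<close> so sparse that the series stays convergent after multiplication by
  these factors (\<open>sparse_range_summable\<close>). For such \<open>b\<close>, adding all sets almost contained in \<open>b\<close> to
  what \<open>S\<close> catches still gives a null set (\<open>thin_sumset_null\<close>).

  Under the continuum hypothesis the sets \<open>S\<close> of words can be well-ordered with countable initial
  segments. Since a countable chain of infinite sets under almost inclusion has an infinite
  pseudo-intersection, recursion along this order yields a strictly decreasing tower of infinite
  sets \<open>x S\<close>, where \<open>x S\<close> is sparse for \<open>S\<close> (\<open>thin_tower\<close>). The members of the tower form the
  uncountable set \<open>X\<close>: given a null set caught by \<open>S\<close>, all but countably many members of \<open>X\<close> are
  almost contained in \<open>x S\<close> and are handled together, and the countably many others one at a time.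
\<close>

section \<open>Null sets of the Cantor space and sets of finite words\<close>

definition stem :: "(nat \<Rightarrow> bit) \<Rightarrow> nat \<Rightarrow> bit list" where
  "stem x k = map x [0..<k]"

definition level :: "bit list set \<Rightarrow> nat \<Rightarrow> bit list set" where
  "level S k = {s \<in> S. length s = k}"

text \<open>The measure of the set of sequences whose initial segment of length \<open>k\<close> lies in \<open>S\<close>.\<close>

definition weight :: "bit list set \<Rightarrow> nat \<Rightarrow> real" where
  "weight S k = card (level S k) / 2 ^ k"

definition infinitely_often :: "bit list set \<Rightarrow> (nat \<Rightarrow> bit) set" where
  "infinitely_often S = {x. \<exists>\<^sub>\<infinity>k. stem x k \<in> S}"

abbreviation coin :: "(nat \<Rightarrow> bit) measure" where
  "coin \<equiv> \<Pi>\<^sub>M n\<in>UNIV. uniform_count_measure UNIV"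

lemma UNIV_bit: "(UNIV :: bit set) = {0, 1}"
  using bit_not_zero_iff by blast

lemma finite_UNIV_bit: "finite (UNIV :: bit set)"
  by (simp add: UNIV_bit)

lemma length_stem [simp]: "length (stem x k) = k"
  by (simp add: stem_def)

lemma stem_eq_iff: "stem x k = stem y k \<longleftrightarrow> (\<forall>i<k. x i = y i)"
  by (auto simp: stem_def)

lemma finite_level: "finite (level S k)"
  by (rule finite_subset[OF _ finite_lists_length_eq[OF finite_UNIV_bit, of k]])
    (auto simp: level_def)

lemma weight_nonneg: "0 \<le> weight S k"
  by (simp add: weight_def)

interpretation bit: prob_space "uniform_count_measure (UNIV :: bit set)"
  by (rule prob_space_uniform_count_measure) (auto simp: finite_UNIV_bit)

interpretation coin: product_prob_space "\<lambda>_ :: nat. uniform_count_measure (UNIV :: bit set)" UNIV ..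

lemma space_coin [simp]: "space coin = UNIV"
  by (simp add: space_PiM space_uniform_count_measure)

lemma coordinate_measurable: "(\<lambda>x. x i) \<in> measurable coin (count_space UNIV)"
  using measurable_component_singleton[of i UNIV "\<lambda>_. uniform_count_measure (UNIV :: bit set)"]
  by (simp cong: measurable_cong_sets add: sets_uniform_count_measure_count_space)

lemma
  shows cylinder_in_sets: "length s = k \<Longrightarrow> {x. stem x k = s} \<in> sets coin"
    and measure_cylinder: "length s = k \<Longrightarrow> measure coin {x. stem x k = s} = 1 / 2 ^ k"
proof -
  assume len: "length s = k"
  have eq: "{x. stem x k = s} = {x \<in> space coin. \<forall>i\<in>{..<k}. x i \<in> {s ! i}}"
    using len by (auto simp: stem_def list_eq_iff_nth_eq)
  show "{x. stem x k = s} \<in> sets coin"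
    unfolding eq
  proof (rule sets.sets_Collect_finite_All)
    show "{x \<in> space coin. x i \<in> {s ! i}} \<in> sets coin" for i
      using measurable_sets[OF coordinate_measurable, of "{s ! i}" i] by (simp add: vimage_def)
  qed simp
  have "emeasure coin {x. stem x k = s} = (\<Prod>i<k. emeasure (uniform_count_measure UNIV) {s ! i})"
    unfolding eq by (rule coin.emeasure_PiM_Collect) auto
  also have "\<dots> = (\<Prod>i<k. ennreal (1 / 2))"
    by (simp add: emeasure_uniform_count_measure finite_UNIV_bit) (simp add: UNIV_bit)
  also have "\<dots> = ennreal (1 / 2 ^ k)"
    by (simp add: ennreal_power power_one_over del: ennreal_half)
  finally show "measure coin {x. stem x k = s} = 1 / 2 ^ k"
    by (simp add: measure_def)
qed

lemma
  shows stem_in_sets: "{x. stem x k \<in> S} \<in> sets coin"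
    and measure_stem: "measure coin {x. stem x k \<in> S} = weight S k"
proof -
  have eq: "{x. stem x k \<in> S} = (\<Union>s\<in>level S k. {x. stem x k = s})"
    by (auto simp: level_def)
  have meas: "{x. stem x k = s} \<in> sets coin" if "s \<in> level S k" for s
    using that by (intro cylinder_in_sets) (auto simp: level_def)
  show "{x. stem x k \<in> S} \<in> sets coin"
    unfolding eq using meas finite_level by (intro sets.finite_UN) auto
  have "measure coin {x. stem x k \<in> S} = (\<Sum>s\<in>level S k. measure coin {x. stem x k = s})"
    unfolding eq using meas finite_level
    by (intro coin.P.finite_measure_finite_Union) (auto simp: disjoint_family_on_def)
  also have "\<dots> = (\<Sum>s\<in>level S k. 1 / 2 ^ k)"
    by (intro sum.cong measure_cylinder) (auto simp: level_def)
  finally show "measure coin {x. stem x k \<in> S} = weight S k"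
    by (simp add: weight_def)
qed

lemma cantor_null_subset:
  "B \<subseteq> A \<Longrightarrow> A \<in> null_sets cantor_measure \<Longrightarrow> B \<in> null_sets cantor_measure"
  unfolding cantor_measure_def by (rule null_sets_completion_subset)

text \<open>This is the Borel--Cantelli lemma.\<close>

lemma infinitely_often_null:
  assumes "summable (weight S)"
  shows "infinitely_often S \<in> null_sets cantor_measure"
proof -
  have "limsup (\<lambda>k. {x. stem x k \<in> S}) \<in> null_sets coin"
    using assms
    by (intro borel_cantelli_limsup1 stem_in_sets)
      (auto simp: measure_stem less_top[symmetric])
  moreover have "infinitely_often S = limsup (\<lambda>k. {x. stem x k \<in> S})"
    by (auto simp: infinitely_often_def limsup_INF_SUP INFM_nat_le)
  ultimately show ?thesis
    by (simp add: cantor_measure_def null_sets_completionI)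
qed

text \<open>
  This is outer regularity, carried over from the space of real sequences, a Polish space into which
  the Cantor space embeds. The last conclusion says that \<open>G\<close> is open in the product topology.
\<close>

lemma null_set_open_cover:
  assumes N: "N \<in> null_sets coin" and e: "0 < (e :: real)"
  obtains G where "N \<subseteq> G" "G \<in> sets coin" "measure coin G < e"
    "\<And>x. x \<in> G \<Longrightarrow> \<exists>k. \<forall>y. stem y k = stem x k \<longrightarrow> y \<in> G"
proof -
  define f :: "(nat \<Rightarrow> bit) \<Rightarrow> nat \<Rightarrow> real" where "f x i = (if x i = 1 then 1 else 0)" for x i
  define g :: "(nat \<Rightarrow> real) \<Rightarrow> nat \<Rightarrow> bit" where "g y i = (if y i = 1 then 1 else 0)" for y i
  have gf: "g (f x) = x" for x
    by (rule ext) (simp add: f_def g_def)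
  have f: "f \<in> measurable coin borel"
  proof -
    have "f \<in> measurable coin (\<Pi>\<^sub>M i\<in>UNIV. borel)"
      unfolding f_def[abs_def]
      by (intro measurable_abs_UNIV measurable_compose[OF coordinate_measurable]) simp
    then show ?thesis
      using sets_PiM_equal_borel measurable_cong_sets by blast
  qed
  have g: "g \<in> measurable borel coin"
  proof -
    have "(\<lambda>y. if y n = 1 then 1 else 0 :: bit) \<in>
        measurable (\<Pi>\<^sub>M i\<in>UNIV. borel :: real measure) (count_space UNIV)" for n :: nat
      by measurable
    then have component: "(\<lambda>y. if y n = 1 then 1 else 0 :: bit) \<in>
        measurable (\<Pi>\<^sub>M i\<in>UNIV. borel :: real measure) (uniform_count_measure UNIV)" for n :: nat
      by (simp only: measurable_cong_sets[OF refl sets_uniform_count_measure_count_space])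
    have "g \<in> measurable (\<Pi>\<^sub>M i\<in>UNIV. borel) coin"
      unfolding g_def[abs_def] by (intro measurable_abs_UNIV component)
    then show ?thesis
      using sets_PiM_equal_borel measurable_cong_sets by blast
  qed
  define M where "M = distr coin borel f"
  interpret M: prob_space M
    unfolding M_def using f by (rule coin.P.prob_space_distr)
  have sets_N: "N \<in> sets coin" and emeasure_N: "emeasure coin N = 0"
    using N by auto
  define B where "B = g -` N"
  have B: "B \<in> sets borel"
    using measurable_sets[OF g sets_N] by (simp add: B_def)
  have "emeasure M B = emeasure coin (f -` B)"
    using f B by (simp add: M_def emeasure_distr)
  also have "f -` B = N"
    by (auto simp: B_def gf)
  finally have "emeasure M B = 0"
    using emeasure_N by simp
  moreover have "emeasure M B = (INF U \<in> {U. B \<subseteq> U \<and> open U}. emeasure M U)"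
    by (rule outer_regular) (use B M.emeasure_space_1 in \<open>auto simp: M_def\<close>)
  ultimately have "(INF U \<in> {U. B \<subseteq> U \<and> open U}. emeasure M U) < ennreal e"
    using e by simp
  then obtain U where U: "B \<subseteq> U" "open U" "emeasure M U < ennreal e"
    by (auto simp: INF_less_iff)
  have sets_U: "f -` U \<in> sets coin"
    using measurable_sets[OF f, of U] U(2) by simp
  show ?thesis
  proof
    show "N \<subseteq> f -` U"
    proof
      fix x assume "x \<in> N"
      then have "f x \<in> B"
        by (simp add: B_def gf)
      then show "x \<in> f -` U"
        using U(1) by auto
    qed
    show "f -` U \<in> sets coin"
      by (fact sets_U)
    have "emeasure coin (f -` U) < ennreal e"
      using U f by (simp add: M_def emeasure_distr)
    then show "measure coin (f -` U) < e"
      using e by (simp add: coin.P.emeasure_eq_measure ennreal_less_iff)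
    fix x assume "x \<in> f -` U"
    then obtain V where V: "f x \<in> Pi\<^sub>E UNIV V" "finite {i. V i \<noteq> UNIV}" "Pi\<^sub>E UNIV V \<subseteq> U"
      using product_topology_open_contains_basis[of "\<lambda>_. euclidean" UNIV U "f x"] U(2)
      by (auto simp: open_fun_def)
    obtain k where k: "{i. V i \<noteq> UNIV} \<subseteq> {..<k}"
      using V(2) finite_nat_iff_bounded by blast
    have "y \<in> f -` U" if "stem y k = stem x k" for y
    proof -
      have "f y i \<in> V i" for i
      proof (cases "i < k")
        case True
        then have "f y i = f x i"
          using that by (simp add: stem_eq_iff f_def)
        then show ?thesis
          using V(1) by auto
      qed (use k in auto)
      then show ?thesis
        using V(3) by auto
    qed
    then show "\<exists>k. \<forall>y. stem y k = stem x k \<longrightarrow> y \<in> f -` U"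
      by blast
  qed
qed

text \<open>
  An open set is the disjoint union of its maximal cylinders, where only cylinders given by words of
  length at least \<open>m\<close> compete. Letting \<open>m\<close> vary then catches a point by words of unbounded length.
\<close>

lemma open_set_stems:
  assumes G: "G \<in> sets coin"
    and nbhd: "\<And>x. x \<in> G \<Longrightarrow> \<exists>k. \<forall>y. stem y k = stem x k \<longrightarrow> y \<in> G"
  obtains S where "\<And>s. s \<in> S \<Longrightarrow> m \<le> length s"
    "\<And>x. x \<in> G \<Longrightarrow> \<exists>k. stem x k \<in> S"
    "\<And>n. (\<Sum>k<n. weight S k) \<le> measure coin G"
proof -
  define admissible where "admissible s \<longleftrightarrow> m \<le> length s \<and> (\<forall>y. stem y (length s) = s \<longrightarrow> y \<in> G)" for s
  define S where "S = {s. admissible s \<and> (\<forall>j<length s. \<not> admissible (take j s))}"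
  have take_stem: "take j (stem x k) = stem x j" if "j \<le> k" for j k x
    using that by (simp add: stem_def take_map)
  show ?thesis
  proof
    show "m \<le> length s" if "s \<in> S" for s
      using that by (simp add: S_def admissible_def)
    show "\<exists>k. stem x k \<in> S" if x: "x \<in> G" for x
    proof -
      obtain k where k: "\<forall>y. stem y k = stem x k \<longrightarrow> y \<in> G"
        using nbhd[OF x] by blast
      have "admissible (stem x (max m k))"
        using k by (auto simp: admissible_def stem_eq_iff)
      then have "admissible (stem x (LEAST k. admissible (stem x k)))"
        by (rule LeastI)
      moreover have "\<not> admissible (take j (stem x (LEAST k. admissible (stem x k))))"
        if "j < (LEAST k. admissible (stem x k))" for j
        using not_less_Least[OF that] that by (simp add: take_stem)
      ultimately show ?thesis
        by (auto simp: S_def)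
    qed
    show "(\<Sum>k<n. weight S k) \<le> measure coin G" for n
    proof -
      have disj: "disjoint_family_on (\<lambda>k. {x. stem x k \<in> S}) {..<n}"
      proof -
        have "False" if "stem x j \<in> S" "stem x k \<in> S" "j < k" for x j k
          using that take_stem[of j k x] by (auto simp: S_def)
        then show ?thesis
          by (auto simp: disjoint_family_on_def) (metis linorder_neqE_nat)
      qed
      have "(\<Sum>k<n. weight S k) = measure coin (\<Union>k<n. {x. stem x k \<in> S})"
        using disj
        by (subst coin.P.finite_measure_finite_Union) (auto simp: measure_stem stem_in_sets)
      also have "\<dots> \<le> measure coin G"
        using G by (intro coin.P.finite_measure_mono) (auto simp: S_def admissible_def)
      finally show ?thesis .
    qed
  qed
qed

text \<open>
  For each \<open>m\<close> the null set has an open cover of measure below \<open>(1/2)\<^sup>m\<close>. Merging the words of all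
  these covers keeps the total weight finite, and each point of the null set meets a word of length
  at least \<open>m\<close> for each \<open>m\<close>.
\<close>

lemma null_set_cover:
  assumes "N \<in> null_sets cantor_measure"
  obtains S where "summable (weight S)" "N \<subseteq> infinitely_often S"
proof -
  obtain N' where N': "N' \<in> null_sets coin" "N \<subseteq> N'"
    using assms by (auto simp: cantor_measure_def null_sets_completion_iff2)
  have "\<exists>S. (\<forall>s\<in>S. m \<le> length s) \<and> (\<forall>x\<in>N'. \<exists>k. stem x k \<in> S) \<and>
      (\<forall>n. (\<Sum>k<n. weight S k) \<le> (1 / 2) ^ m)" for m
  proof -
    obtain G where G: "N' \<subseteq> G" "G \<in> sets coin" "measure coin G < (1 / 2) ^ m"
      "\<And>x. x \<in> G \<Longrightarrow> \<exists>k. \<forall>y. stem y k = stem x k \<longrightarrow> y \<in> G"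
      using null_set_open_cover[OF N'(1), of "(1 / 2) ^ m"] by auto
    obtain S where "\<And>s. s \<in> S \<Longrightarrow> m \<le> length s" "\<And>x. x \<in> G \<Longrightarrow> \<exists>k. stem x k \<in> S"
      "\<And>n. (\<Sum>k<n. weight S k) \<le> measure coin G"
      using open_set_stems[OF G(2,4)] by blast
    with G(1,3) show ?thesis
      by (meson subsetD less_imp_le order_trans)
  qed
  then obtain S where S: "\<And>m s. s \<in> S m \<Longrightarrow> m \<le> length s"
    "\<And>m x. x \<in> N' \<Longrightarrow> \<exists>k. stem x k \<in> S m"
    "\<And>m n. (\<Sum>k<n. weight (S m) k) \<le> (1 / 2) ^ m"
    by metis
  define T where "T = (\<Union>m. S m)"
  have weight_T: "weight T k \<le> (\<Sum>m\<le>k. weight (S m) k)" for k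
  proof -
    have "level T k = (\<Union>m\<le>k. level (S m) k)"
      using S(1) by (auto simp: level_def T_def)
    then have "card (level T k) \<le> (\<Sum>m\<le>k. card (level (S m) k))"
      by (simp add: card_UN_le)
    then have "real (card (level T k)) \<le> (\<Sum>m\<le>k. real (card (level (S m) k)))"
      by (metis of_nat_le_iff of_nat_sum)
    then show ?thesis
      by (simp add: weight_def sum_divide_distrib[symmetric] divide_right_mono)
  qed
  show ?thesis
  proof
    show "summable (weight T)"
    proof (rule summableI_nonneg_bounded)
      show "(\<Sum>k<n. weight T k) \<le> 2" for n
      proof -
        have "(\<Sum>k<n. weight T k) \<le> (\<Sum>k<n. \<Sum>m<n. weight (S m) k)"
          by (intro sum_mono order_trans[OF weight_T] sum_mono2) (auto simp: weight_nonneg)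
        also have "\<dots> = (\<Sum>m<n. \<Sum>k<n. weight (S m) k)"
          by (rule sum.swap)
        also have "\<dots> \<le> (\<Sum>m<n. (1 / 2) ^ m)"
          by (intro sum_mono S(3))
        also have "\<dots> \<le> 2"
          by (simp add: sum_gp_strict)
        finally show ?thesis .
      qed
    qed (rule weight_nonneg)
    show "N \<subseteq> infinitely_often T"
    proof
      fix x assume "x \<in> N"
      then have "x \<in> N'"
        using N'(2) by auto
      have "\<exists>k\<ge>m. stem x k \<in> T" for m
        using S(2)[OF \<open>x \<in> N'\<close>, of m] S(1)[of "stem x _" m] by (auto simp: T_def)
      then show "x \<in> infinitely_often T"
        by (simp add: infinitely_often_def INFM_nat_le)
    qed
  qed
qed

section \<open>Sums of small sets and null sets\<close>

text \<open>
  A sum \<open>y + x\<close> is caught by the words that arise by adding an initial segment of a member of \<open>Y\<close> to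
  a word of \<open>S\<close> of the same length.
\<close>

lemma sumset_infinitely_often_null:
  assumes m: "\<And>k. card ((\<lambda>y. stem y k) ` Y) \<le> m k"
    and sum: "summable (\<lambda>k. real (m k) * weight S k)"
  shows "Y + infinitely_often S \<in> null_sets cantor_measure"
proof -
  define I where "I k = (\<lambda>(u, s). map2 (+) u s) ` ((\<lambda>y. stem y k) ` Y \<times> level S k)" for k
  define T where "T = (\<Union>k. I k)"
  have length_I: "length t = k" if "t \<in> I k" for t k
    using that by (auto simp: I_def level_def)
  have level_T: "level T k = I k" for k
  proof (intro equalityI subsetI)
    fix t assume "t \<in> level T k"
    then obtain j where "t \<in> I j" "length t = k"
      unfolding level_def T_def by blast
    then show "t \<in> I k"
      using length_I[of t j] by simp
  next
    fix t assume "t \<in> I k"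
    then show "t \<in> level T k"
      using length_I[of t k] by (auto simp: level_def T_def)
  qed
  have weight_T: "weight T k \<le> real (m k) * weight S k" for k
  proof -
    have fin: "finite ((\<lambda>y. stem y k) ` Y)"
      by (rule finite_subset[OF _ finite_lists_length_eq[OF finite_UNIV_bit, of k]]) auto
    have "card (level T k) \<le> card ((\<lambda>y. stem y k) ` Y \<times> level S k)"
      unfolding level_T I_def using fin finite_level by (intro card_image_le) auto
    also have "\<dots> \<le> m k * card (level S k)"
      using m by (simp add: card_cartesian_product)
    finally have "real (card (level T k)) \<le> real (m k) * real (card (level S k))"
      by (metis of_nat_le_iff of_nat_mult)
    then show ?thesis
      by (simp add: weight_def divide_right_mono)
  qed
  have "summable (weight T)"
    using sum by (rule summable_comparison_test'[where N = 0]) (use weight_T weight_nonneg in auto)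
  moreover have "Y + infinitely_often S \<subseteq> infinitely_often T"
  proof
    fix z assume "z \<in> Y + infinitely_often S"
    then obtain y x where z: "z = y + x" and y: "y \<in> Y" and x: "x \<in> infinitely_often S"
      by (auto elim!: set_plus_elim)
    have "stem z k \<in> T" if "stem x k \<in> S" for k
    proof -
      have "stem z k = map2 (+) (stem y k) (stem x k)"
        by (simp add: z stem_def list_eq_iff_nth_eq)
      moreover have "stem x k \<in> level S k"
        using that by (simp add: level_def)
      ultimately have "stem z k \<in> I k"
        unfolding I_def using y by (intro image_eqI[of _ _ "(stem y k, stem x k)"]) auto
      then show ?thesis
        by (auto simp: T_def)
    qed
    then show "z \<in> infinitely_often T"
      using x unfolding infinitely_often_def by (auto elim: INFM_mono)
  qed
  ultimately show ?thesis
    using infinitely_often_null[of T] cantor_null_subset by blast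
qed

definition characteristic :: "nat set \<Rightarrow> nat \<Rightarrow> bit" where
  "characteristic a = (\<lambda>i. if i \<in> a then 1 else 0)"

lemma inj_characteristic: "inj characteristic"
  by (rule injI) (auto simp: characteristic_def fun_eq_iff split: if_splits)

definition almost_subset :: "nat set \<Rightarrow> nat set \<Rightarrow> bool" (infix \<open>\<subseteq>\<^sup>*\<close> 50) where
  "a \<subseteq>\<^sup>* b \<longleftrightarrow> finite (a - b)"

text \<open>
  The power of \<open>2\<close> counts the initial segments of length \<open>k\<close> of the characteristic functions of the
  subsets of \<open>b\<close>.
\<close>

definition thin_for :: "bit list set \<Rightarrow> nat set \<Rightarrow> bool" where
  "thin_for S b \<longleftrightarrow> summable (\<lambda>k. 2 ^ card (b \<inter> {..<k}) * weight S k)"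

text \<open>
  The sets almost contained in \<open>b\<close> are the subsets of \<open>b \<union> {..<n}\<close> for varying \<open>n\<close>. Passing from \<open>b\<close>
  to \<open>b \<union> {..<n}\<close> costs at most the constant factor \<open>2\<^sup>n\<close> in the number of initial segments.
\<close>

lemma thin_sumset_null:
  assumes "thin_for S b"
  shows "characteristic ` {a. a \<subseteq>\<^sup>* b} + infinitely_often S \<in> null_sets cantor_measure"
proof -
  define Y where "Y n = characteristic ` Pow (b \<union> {..<n})" for n
  have card_Y: "card ((\<lambda>y. stem y k) ` Y n) \<le> 2 ^ n * 2 ^ card (b \<inter> {..<k})" for n k
  proof -
    define D where "D = (b \<union> {..<n}) \<inter> {..<k}"
    have "(\<lambda>y. stem y k) ` Y n \<subseteq> (\<lambda>a. stem (characteristic a) k) ` Pow D"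
    proof
      fix s assume "s \<in> (\<lambda>y. stem y k) ` Y n"
      then obtain a where a: "a \<subseteq> b \<union> {..<n}" "s = stem (characteristic a) k"
        by (auto simp: Y_def)
      have "s = stem (characteristic (a \<inter> {..<k})) k" "a \<inter> {..<k} \<in> Pow D"
        using a by (auto simp: stem_eq_iff characteristic_def D_def)
      then show "s \<in> (\<lambda>a. stem (characteristic a) k) ` Pow D"
        by blast
    qed
    moreover have "finite D"
      by (simp add: D_def)
    ultimately have "card ((\<lambda>y. stem y k) ` Y n) \<le> card (Pow D)"
      by (meson card_image_le card_mono finite_Pow_iff finite_imageI order_trans)
    also have "\<dots> = 2 ^ card D"
      using \<open>finite D\<close> by (rule card_Pow)
    also have "\<dots> \<le> 2 ^ (n + card (b \<inter> {..<k}))"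
    proof (rule power_increasing)
      have "card D \<le> card ({..<n} \<union> b \<inter> {..<k})"
        by (rule card_mono) (auto simp: D_def)
      also have "\<dots> \<le> n + card (b \<inter> {..<k})"
        using card_Un_le[of "{..<n}" "b \<inter> {..<k}"] by simp
      finally show "card D \<le> n + card (b \<inter> {..<k})" .
    qed simp
    finally show ?thesis
      by (simp add: power_add)
  qed
  have "Y n + infinitely_often S \<in> null_sets cantor_measure" for n
  proof (rule sumset_infinitely_often_null[OF card_Y])
    have "summable (\<lambda>k. 2 ^ n * (2 ^ card (b \<inter> {..<k}) * weight S k))"
      using assms unfolding thin_for_def by (rule summable_mult)
    then show "summable (\<lambda>k. real (2 ^ n * 2 ^ card (b \<inter> {..<k})) * weight S k)"
      by (simp add: mult.assoc)
  qed
  then have "(\<Union>n. Y n + infinitely_often S) \<in> null_sets cantor_measure"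
    by (intro null_sets_UN)
  moreover have "characteristic ` {a. a \<subseteq>\<^sup>* b} + infinitely_often S \<subseteq> (\<Union>n. Y n + infinitely_often S)"
  proof
    fix z assume "z \<in> characteristic ` {a. a \<subseteq>\<^sup>* b} + infinitely_often S"
    then obtain a x where a: "a \<subseteq>\<^sup>* b" and z: "z = characteristic a + x" "x \<in> infinitely_often S"
      by (auto elim!: set_plus_elim)
    obtain n where "a - b \<subseteq> {..<n}"
      using a finite_nat_iff_bounded unfolding almost_subset_def by blast
    then have "characteristic a \<in> Y n"
      by (auto simp: Y_def)
    then show "z \<in> (\<Union>n. Y n + infinitely_often S)"
      using z by (auto intro: set_plus_intro)
  qed
  ultimately show ?thesis
    by (rule cantor_null_subset[rotated])
qed

lemma countable_sumset_null:
  assumes "countable C" "summable (weight S)"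
  shows "C + infinitely_often S \<in> null_sets cantor_measure"
proof -
  have "{y} + infinitely_often S \<in> null_sets cantor_measure" for y
    by (rule sumset_infinitely_often_null[where m = "\<lambda>_. 1"]) (use assms in auto)
  then have "(\<Union>y\<in>C. {y} + infinitely_often S) \<in> null_sets cantor_measure"
    using assms(1) by (intro null_sets_UN')
  moreover have "C + infinitely_often S = (\<Union>y\<in>C. {y} + infinitely_often S)"
    by (auto simp: set_plus_def)
  ultimately show ?thesis
    by simp
qed

section \<open>Sparse pseudo-intersections\<close>

lemma strict_mono_choice:
  fixes B :: "nat \<Rightarrow> nat set"
  assumes "\<And>n. infinite (B n)"
  obtains p where "strict_mono p" "\<And>n. p n \<in> B n"
proof -
  have "\<exists>p. \<forall>n. p n \<in> B n \<and> p n < p (Suc n)"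
  proof (rule dependent_nat_choice[where P = "\<lambda>n i. i \<in> B n" and Q = "\<lambda>n i j. i < j"])
    show "\<exists>i. i \<in> B 0"
      using infinite_imp_nonempty[OF assms] by blast
    show "\<exists>j. j \<in> B (Suc n) \<and> i < j" for i n
      using assms[of "Suc n"] unfolding infinite_nat_iff_unbounded by blast
  qed
  then obtain p where "\<And>n. p n \<in> B n" "\<And>n. p n < p (Suc n)"
    by blast
  then show ?thesis
    using that[of p] by (simp add: strict_mono_Suc_iff)
qed

text \<open>
  Write \<open>2 ^ n\<close> as \<open>1\<close> plus the sum of the \<open>2 ^ j\<close> with \<open>j < n\<close> and interchange the summations:
  the element \<open>p j\<close> then contributes \<open>2 ^ j\<close> times the tail of the series beyond \<open>p j\<close>, which is at
  most \<open>2 ^ j * (1 / 4) ^ j\<close>.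
\<close>

lemma sparse_range_summable:
  fixes c :: "nat \<Rightarrow> real"
  assumes c: "\<And>k. 0 \<le> c k" "summable c" and p: "strict_mono p"
    and tail: "\<And>j n. (\<Sum>k\<in>{p j<..<n}. c k) \<le> (1 / 4) ^ j"
  shows "summable (\<lambda>k. 2 ^ card (range p \<inter> {..<k}) * c k)"
proof (rule summableI_nonneg_bounded)
  have expand: "2 ^ card (range p \<inter> {..<k}) = 1 + (\<Sum>j | p j < k. 2 ^ j :: real)" for k
  proof -
    define n where "n = (LEAST j. k \<le> p j)"
    have "k \<le> p n"
      unfolding n_def using strict_mono_imp_increasing[OF p] by (rule LeastI)
    then have "j < n" if "p j < k" for j
      using that strict_mono_less[OF p, of j n] by simp
    moreover have "p j < k" if "j < n" for j
      using not_less_Least[of j "\<lambda>j. k \<le> p j"] that by (simp add: n_def)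
    ultimately have initial: "{j. p j < k} = {..<n}"
      by blast
    have "range p \<inter> {..<k} = p ` {j. p j < k}"
      by auto
    then have "card (range p \<inter> {..<k}) = n"
      using strict_mono_imp_inj_on[OF p] by (simp add: initial card_image inj_on_subset)
    then show ?thesis
      by (simp add: initial sum_gp_strict)
  qed
  show "(\<Sum>k<n. 2 ^ card (range p \<inter> {..<k}) * c k) \<le> suminf c + 2" for n
  proof -
    have "(\<Sum>k<n. 2 ^ card (range p \<inter> {..<k}) * c k) =
        (\<Sum>k<n. c k) + (\<Sum>k<n. \<Sum>j | p j < k. 2 ^ j * c k)"
      by (simp add: expand distrib_right sum.distrib sum_distrib_right)
    also have "(\<Sum>k<n. \<Sum>j | p j < k. 2 ^ j * c k) =
        (\<Sum>k<n. \<Sum>j<n. if p j < k then 2 ^ j * c k else 0)"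
    proof (rule sum.cong[OF refl])
      fix k assume "k \<in> {..<n}"
      then have "{j. p j < k} = {j \<in> {..<n}. p j < k}"
        using strict_mono_imp_increasing[OF p] by (auto intro: le_less_trans less_trans)
      then show "(\<Sum>j | p j < k. 2 ^ j * c k) = (\<Sum>j<n. if p j < k then 2 ^ j * c k else 0)"
        by (simp add: sum.inter_filter[symmetric])
    qed
    also have "\<dots> = (\<Sum>j<n. \<Sum>k<n. if p j < k then 2 ^ j * c k else 0)"
      by (rule sum.swap)
    also have "\<dots> = (\<Sum>j<n. 2 ^ j * (\<Sum>k\<in>{p j<..<n}. c k))"
    proof (rule sum.cong[OF refl])
      fix j
      have "{p j<..<n} = {k \<in> {..<n}. p j < k}"
        by auto
      then show "(\<Sum>k<n. if p j < k then 2 ^ j * c k else 0) = 2 ^ j * (\<Sum>k\<in>{p j<..<n}. c k)"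
        by (simp add: sum.inter_filter[symmetric] sum_distrib_left)
    qed
    also have "\<dots> \<le> (\<Sum>j<n. 2 ^ j * (1 / 4) ^ j)"
      by (intro sum_mono mult_left_mono tail) auto
    also have "\<dots> = (\<Sum>j<n. (1 / 2) ^ j)"
      by (simp add: power_mult_distrib[symmetric])
    also have "\<dots> \<le> 2"
      by (simp add: sum_gp_strict)
    finally show ?thesis
      using sum_le_suminf[OF c(2), of "{..<n}"] c(1) by simp
  qed
qed (use c in auto)

text \<open>
  One diagonal choice makes the set both almost contained in all members of the chain and sparse with
  respect to \<open>c\<close>: the \<open>n\<close>-th element is taken from the intersection of an initial part of an
  enumeration of the chain, beyond the point where the tails of the series drop below \<open>(1 / 4) ^ n\<close>.
  Keeping only every other chosen element makes the inclusions strict modulo finite sets.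
\<close>

lemma thin_pseudo_intersection:
  fixes c :: "nat \<Rightarrow> real"
  assumes F: "countable F" "\<And>A. A \<in> F \<Longrightarrow> infinite A"
    and chain: "\<And>A B. A \<in> F \<Longrightarrow> B \<in> F \<Longrightarrow> A \<subseteq>\<^sup>* B \<or> B \<subseteq>\<^sup>* A"
    and c: "\<And>k. 0 \<le> c k" "summable c"
  obtains b where "infinite b" "\<And>A. A \<in> F \<Longrightarrow> b \<subseteq>\<^sup>* A" "\<And>A. A \<in> F \<Longrightarrow> \<not> A \<subseteq>\<^sup>* b"
    "summable (\<lambda>k. 2 ^ card (b \<inter> {..<k}) * c k)"
proof -
  \<comment> \<open>Adjoining \<open>UNIV\<close> makes the family nonempty, so that it can be enumerated.\<close>
  define A where "A = from_nat_into (insert UNIV F)"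
  have range_A: "range A = insert UNIV F"
    unfolding A_def using F(1) by (intro range_from_nat_into) auto
  have inf_A: "infinite (A i)" for i
    using range_A F(2) by (metis infinite_UNIV_nat insertE rangeI)
  have chain_A: "A i \<subseteq>\<^sup>* A j \<or> A j \<subseteq>\<^sup>* A i" for i j
  proof -
    have "A i \<in> insert UNIV F" "A j \<in> insert UNIV F"
      using range_A by auto
    then show ?thesis
      using chain by (auto simp: almost_subset_def)
  qed
  have "\<exists>j. A j \<subseteq>\<^sup>* (\<Inter>i\<le>n. A i)" for n
  proof (induction n)
    case 0
    show ?case
      by (rule exI[of _ 0]) (simp add: almost_subset_def)
  next
    case (Suc n)
    then obtain j where j: "A j \<subseteq>\<^sup>* (\<Inter>i\<le>n. A i)"
      by blast
    have sub: "A l \<subseteq>\<^sup>* (\<Inter>i\<le>Suc n. A i)" if "A l \<subseteq>\<^sup>* A j" "A l \<subseteq>\<^sup>* A (Suc n)" for l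
    proof -
      have "A l - (\<Inter>i\<le>Suc n. A i) \<subseteq> (A l - A j) \<union> (A j - (\<Inter>i\<le>n. A i)) \<union> (A l - A (Suc n))"
        by (auto simp: le_Suc_eq)
      then show ?thesis
        using that j unfolding almost_subset_def by (meson finite_UnI finite_subset)
    qed
    have "A l \<subseteq>\<^sup>* A l" for l
      by (simp add: almost_subset_def)
    then show ?case
      using chain_A[of j "Suc n"] sub by blast
  qed
  then have inf_Int: "infinite (\<Inter>i\<le>n. A i)" for n
    using inf_A unfolding almost_subset_def by (metis Diff_infinite_finite)
  define B where "B n = (\<Inter>i\<le>n. A i) \<inter> {i. \<forall>l. (\<Sum>k\<in>{i<..<l}. c k) \<le> (1 / 4) ^ n}" for n
  have "infinite (B n)" for n
  proof -
    obtain N where N: "\<And>i l. i \<ge> N \<Longrightarrow> norm (\<Sum>k\<in>{i..<l}. c k) < (1 / 4) ^ n"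
      using c(2) unfolding summable_Cauchy by (metis zero_less_power zero_less_divide_1_iff zero_less_numeral)
    have "(\<Sum>k\<in>{i<..<l}. c k) \<le> (1 / 4) ^ n" if "i \<ge> N" for i l
    proof -
      have "(\<Sum>k\<in>{i<..<l}. c k) \<le> (\<Sum>k\<in>{i..<l}. c k)"
        using c(1) by (intro sum_mono2) auto
      also have "\<dots> \<le> (1 / 4) ^ n"
        using N[OF that, of l] by simp
      finally show ?thesis .
    qed
    then have "(\<Inter>i\<le>n. A i) - {..<N} \<subseteq> B n"
      by (auto simp: B_def)
    then show ?thesis
      using inf_Int[of n] by (meson Diff_infinite_finite finite_lessThan finite_subset)
  qed
  then obtain p where p: "strict_mono p" "\<And>n. p n \<in> B n"
    using strict_mono_choice by blast
  have inj_p: "inj p"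
    using p(1) by (rule strict_mono_imp_inj_on)
  have sub_A: "range p \<subseteq>\<^sup>* A i" for i
  proof -
    have "range p - A i \<subseteq> p ` {..<i}"
      using p(2) by (fastforce simp: B_def not_le[symmetric])
    then show ?thesis
      unfolding almost_subset_def using finite_subset by blast
  qed
  define b where "b = p ` {n. even n}"
  have sub_b: "b \<subseteq> range p"
    by (auto simp: b_def)
  have "\<exists>n>m. even n" "\<exists>n>m. odd n" for m :: nat
    using exI[of _ "2 * m + 2"] exI[of _ "2 * m + 1"] by (presburger, presburger)
  then have infinite_even: "infinite {n :: nat. even n}" "infinite {n :: nat. odd n}"
    by (auto simp: infinite_nat_iff_unbounded)
  show ?thesis
  proof
    show "infinite b"
      unfolding b_def using infinite_even inj_p by (simp add: finite_image_iff inj_on_subset)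
    fix C assume "C \<in> F"
    then obtain i where C: "C = A i"
      using range_A by (metis insertCI rangeE)
    show "b \<subseteq>\<^sup>* C"
      using sub_A[of i] sub_b unfolding C almost_subset_def by (meson Diff_mono finite_subset order_refl)
    show "\<not> C \<subseteq>\<^sup>* b"
    proof
      assume "C \<subseteq>\<^sup>* b"
      have "p ` {n. odd n} \<subseteq> (range p - A i) \<union> (C - b)"
        using inj_p by (auto simp: b_def C inj_eq)
      then have "finite (p ` {n. odd n})"
        using \<open>C \<subseteq>\<^sup>* b\<close> sub_A[of i] unfolding almost_subset_def by (meson finite_UnI finite_subset)
      then show False
        using infinite_even inj_p by (simp add: finite_image_iff inj_on_subset)
    qed
  next
    have "summable (\<lambda>k. 2 ^ card (range p \<inter> {..<k}) * c k)"
      using p by (intro sparse_range_summable c) (auto simp: B_def)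
    then show "summable (\<lambda>k. 2 ^ card (b \<inter> {..<k}) * c k)"
    proof (rule summable_comparison_test'[where N = 0])
      fix k
      have "card (b \<inter> {..<k}) \<le> card (range p \<inter> {..<k})"
        using sub_b by (intro card_mono) auto
      then show "norm (2 ^ card (b \<inter> {..<k}) * c k) \<le> 2 ^ card (range p \<inter> {..<k}) * c k"
        using c(1)[of k] by (simp add: abs_mult mult_right_mono)
    qed
  qed
qed

section \<open>The tower and the null-additive set\<close>

lemma word_sets_eqpoll_reals: "(UNIV :: bit list set set) \<approx> (UNIV :: real set)"
proof -
  have "countable (UNIV :: bit set)"
    using finite_UNIV_bit by (rule countable_finite)
  then have "countable (UNIV :: bit list set)"
    using countable_lists[of "UNIV :: bit set"] by simp
  moreover have "infinite (UNIV :: bit list set)"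
    by (rule infinite_UNIV_listI)
  ultimately obtain g :: "bit list \<Rightarrow> nat" where "bij g"
    by (rule countableE_infinite)
  then have "bij (image g)"
    by (metis bij_betw_Pow Pow_UNIV)
  then have "(UNIV :: bit list set set) \<approx> (UNIV :: nat set set)"
    unfolding eqpoll_def by blast
  then show ?thesis
    using nat_sets_eqpoll_reals by (rule eqpoll_trans)
qed

text \<open>
  In a well-order of minimal type each proper initial segment has smaller cardinality than the whole
  set, which under the continuum hypothesis means that it is countable.
\<close>

lemma continuum_hypothesis_well_order:
  assumes continuum_hypothesis
  obtains r :: "bit list set rel" where "wf r" "\<And>S T. S \<noteq> T \<Longrightarrow> (S, T) \<in> r \<or> (T, S) \<in> r"
    "\<And>S. countable {T. (T, S) \<in> r}"
proof -
  define R where "R = |UNIV :: bit list set set|"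
  have "R =o |UNIV :: real set|"
    using word_sets_eqpoll_reals unfolding R_def eqpoll_def by (simp add: card_of_ordIso)
  then have R: "R =o cardSuc natLeq"
    using assms ordIso_transitive unfolding continuum_hypothesis_def by blast
  have wo: "well_order_on UNIV R"
    unfolding R_def by (rule card_of_well_order_on)
  show ?thesis
  proof
    show "wf (R - Id)"
      using wo by (simp add: well_order_on_def)
    show "(S, T) \<in> R - Id \<or> (T, S) \<in> R - Id" if "S \<noteq> T" for S T
      using wo that by (auto simp: well_order_on_def linear_order_on_def total_on_def)
    show "countable {T. (T, S) \<in> R - Id}" for S
    proof -
      have "{T. (T, S) \<in> R - Id} = underS R S"
        by (auto simp: underS_def)
      moreover have "|underS R S| <o R"
        unfolding R_def by (rule card_of_underS[OF card_of_Card_order]) (simp add: Field_card_of)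
      then have "|underS R S| <o cardSuc natLeq"
        using R by (rule ordLess_ordIso_trans)
      then have "|underS R S| \<le>o natLeq"
        using cardSuc_ordLeq_ordLess[OF natLeq_Card_order card_of_Card_order] by blast
      then have "|underS R S| \<le>o |UNIV :: nat set|"
        using card_of_nat ordIso_symmetric ordLeq_ordIso_trans by blast
      then have "countable (underS R S)"
        by (auto simp: countable_def card_of_ordLeq[symmetric])
      ultimately show ?thesis
        by simp
    qed
  qed
qed

text \<open>
  The requirement at \<open>S\<close> compares \<open>x S\<close> with all earlier sets, so at each stage these form a chain
  under almost inclusion. The chain is countable and hence has a sparse pseudo-intersection.
\<close>

lemma thin_tower:
  assumes r: "wf r" "\<And>S T. S \<noteq> T \<Longrightarrow> (S, T) \<in> r \<or> (T, S) \<in> r"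
    and count: "\<And>S. countable {T. (T, S) \<in> r}"
  obtains x :: "bit list set \<Rightarrow> nat set" where
    "\<And>S. summable (weight S) \<Longrightarrow> thin_for S (x S)"
    "\<And>S T. (T, S) \<in> r \<Longrightarrow> x S \<subseteq>\<^sup>* x T" "\<And>S T. (T, S) \<in> r \<Longrightarrow> \<not> x T \<subseteq>\<^sup>* x S"
proof -
  define P where "P x S b \<longleftrightarrow> infinite b \<and> (summable (weight S) \<longrightarrow> thin_for S b) \<and>
    (\<forall>T. (T, S) \<in> r \<longrightarrow> b \<subseteq>\<^sup>* x T \<and> \<not> x T \<subseteq>\<^sup>* b)" for x S b
  have "\<exists>x. \<forall>S. P x S (x S)"
  proof (rule dependent_wf_choice[OF r(1)])
    show "P x S b = P y S b" if "\<And>T. (T, S) \<in> r \<Longrightarrow> x T = y T" for x y S b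
      using that by (auto simp: P_def)
    show "\<exists>b. P x S b" if IH: "\<And>T. (T, S) \<in> r \<Longrightarrow> P x T (x T)" for S x
    proof -
      define F where "F = x ` {T. (T, S) \<in> r}"
      \<comment> \<open>If \<open>S\<close> has infinite weight, no sparseness is asked for; the zero series then serves as \<open>c\<close>.\<close>
      define c where "c = (if summable (weight S) then weight S else (\<lambda>_. 0))"
      have c: "0 \<le> c k" "summable c" for k
        by (simp_all add: c_def weight_nonneg)
      have F: "countable F" "\<And>A. A \<in> F \<Longrightarrow> infinite A"
        using count IH by (auto simp: F_def P_def)
      have chain: "A \<subseteq>\<^sup>* B \<or> B \<subseteq>\<^sup>* A" if AB: "A \<in> F" "B \<in> F" for A B
      proof -
        obtain T U where T: "A = x T" "(T, S) \<in> r" and U: "B = x U" "(U, S) \<in> r"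
          using AB by (auto simp: F_def)
        show ?thesis
          using IH[OF T(2)] IH[OF U(2)] r(2)[of T U]
          by (cases "T = U") (auto simp: T U P_def almost_subset_def)
      qed
      obtain b where b: "infinite b" "\<And>A. A \<in> F \<Longrightarrow> b \<subseteq>\<^sup>* A" "\<And>A. A \<in> F \<Longrightarrow> \<not> A \<subseteq>\<^sup>* b"
        "summable (\<lambda>k. 2 ^ card (b \<inter> {..<k}) * c k)"
        using thin_pseudo_intersection[OF F chain c] by blast
      have thin: "thin_for S b" if "summable (weight S)"
      proof -
        have "c = weight S"
          using that by (simp add: c_def)
        then show ?thesis
          using b(4) by (simp add: thin_for_def)
      qed
      have below: "b \<subseteq>\<^sup>* x T \<and> \<not> x T \<subseteq>\<^sup>* b" if "(T, S) \<in> r" for T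
      proof -
        have "x T \<in> F"
          using that by (auto simp: F_def)
        then show ?thesis
          using b(2,3)[of "x T"] by blast
      qed
      have "P x S b"
        unfolding P_def using b(1) thin below by (intro conjI allI impI) simp_all
      then show ?thesis ..
    qed
  qed
  then obtain x where x: "P x S (x S)" for S
    by blast
  show ?thesis
  proof (rule that[of x])
    show "thin_for S (x S)" if "summable (weight S)" for S
      using x[of S] that by (simp add: P_def)
    show "x S \<subseteq>\<^sup>* x T" "\<not> x T \<subseteq>\<^sup>* x S" if "(T, S) \<in> r" for S T
      using x[of S] that by (simp_all add: P_def)
  qed
qed

theorem theorem19:
  assumes "continuum_hypothesis"
  shows "\<exists>X :: (nat \<Rightarrow> bit) set. uncountable X \<and> null_additive X"
proof -
  obtain r :: "bit list set rel" where r: "wf r" "\<And>S T. S \<noteq> T \<Longrightarrow> (S, T) \<in> r \<or> (T, S) \<in> r"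
    and count: "\<And>S. countable {T. (T, S) \<in> r}"
    using continuum_hypothesis_well_order[OF assms] by blast
  obtain x where thin: "\<And>S. summable (weight S) \<Longrightarrow> thin_for S (x S)"
    and tower: "\<And>S T. (T, S) \<in> r \<Longrightarrow> x S \<subseteq>\<^sup>* x T" "\<And>S T. (T, S) \<in> r \<Longrightarrow> \<not> x T \<subseteq>\<^sup>* x S"
    using thin_tower[OF r count] by blast
  define X where "X = range (\<lambda>S. characteristic (x S))"
  have "inj x"
    using r(2) tower by (metis injI)
  then have "inj (\<lambda>S. characteristic (x S))"
    using inj_characteristic by (auto simp: inj_def)
  moreover have "uncountable (UNIV :: bit list set set)"
    using word_sets_eqpoll_reals uncountable_UNIV_real by (metis countable_eqpoll eqpoll_sym)
  ultimately have "uncountable X"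
    unfolding X_def by (metis countable_image_inj_on)
  moreover have "null_additive X"
    unfolding null_additive_def
  proof (intro allI impI)
    fix N assume "N \<in> null_sets cantor_measure"
    then obtain S where S: "summable (weight S)" "N \<subseteq> infinitely_often S"
      by (rule null_set_cover)
    define C where "C = (\<lambda>T. characteristic (x T)) ` {T. (T, S) \<in> r}"
    have "X \<subseteq> C \<union> characteristic ` {a. a \<subseteq>\<^sup>* x S}"
    proof -
      have "characteristic (x T) \<in> C \<union> characteristic ` {a. a \<subseteq>\<^sup>* x S}" for T
        using r(2)[of T S] tower(1)[of S T] by (cases "T = S") (auto simp: C_def almost_subset_def)
      then show ?thesis
        by (auto simp: X_def)
    qed
    then have "X + N \<subseteq> (C + infinitely_often S) \<union> (characteristic ` {a. a \<subseteq>\<^sup>* x S} + infinitely_often S)"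
      using S(2) by (fastforce simp: set_plus_def)
    moreover have "C + infinitely_often S \<in> null_sets cantor_measure"
      using count S(1) by (intro countable_sumset_null) (auto simp: C_def)
    moreover have "characteristic ` {a. a \<subseteq>\<^sup>* x S} + infinitely_often S \<in> null_sets cantor_measure"
      using thin[OF S(1)] by (rule thin_sumset_null)
    ultimately show "X + N \<in> null_sets cantor_measure"
      using cantor_null_subset null_sets.Un by metis
  qed
  ultimately show ?thesis
    by blast
qed

end
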